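(* Let $n\ge 1$ be an integer and let $h_n:[0,1)^n\to[0,1)$ be the increasing function $$h_n(\mathbf{x})=\min\left(1-2^{-(n+1)},\ (2^{n+1}-1)\min_{1\le i\le n}x_i\right).$$ For any algorithm $A\in\mathcal{A}_n$ and any $(\mathbf{x},x_{n+1})\in[0,1)^{n+1}$, $$|A(h_n,\mathbf{x},x_{n+1})|\ge n+1.$$ In particular, $\mathcal{B}(n)\ge n+1$.
   Context: Increasing functions. A function $f$ of $n$ real variables is called increasing if $f(\mathbf{x}')\le f(\mathbf{x})$ whenever every coordinate of $\mathbf{x}'$ is less than or equal to the corresponding coordinate of $\mathbf{x}$. $\mathcal{F}_n$ denotes the set of increasing functions $[0,1)^n\to[0,1)$. Bits. For $x\in[0,1)$, $x^{(i)}\in\{0,1\}$ denotes the $i$-th bit of the binary expansion $x=0.x^{(1)}x^{(2)}x^{(3)}\ldots$, where the expansion is chosen not to end in an infinite tail of 1's. Cuts and feasible sets. Let $\bar{x}_1,\ldots,\bar{x}_{n+1}$ be $n+1$ distinct symbols, called cuts. A string of cuts encodes an order of revealing bits of a point $(\mathbf{x},x_{n+1})=(x_1,\ldots,x_{n+1})\in[0,1)^{n+1}$: the $m$-th occurrence of $\bar{x}_j$ means that the bit $x_j^{(m)}$ is revealed. For a finite string of cuts $s$, let $k_j$ be the number of occurrences of $\bar{x}_j$ in $s$ and let $x_j^*=0.x_j^{(1)}\ldots x_j^{(k_j)}$ be the truncation of $x_j$ to its first $k_j$ bits. The feasible set after $s$ (for the input $(\mathbf{x},x_{n+1})$) is the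 box $S=\prod_{j=1}^{n+1}[x_j^*,x_j^*+2^{-k_j})$. Crossing. A function $f\in\mathcal{F}_n$ crosses a box $S\subseteq[0,1)^{n+1}$ if both sets $S\cap\{(\mathbf{y},y_{n+1}): f(\mathbf{y})<y_{n+1}\}$ and $S\cap\{(\mathbf{y},y_{n+1}): f(\mathbf{y})>y_{n+1}\}$ have positive Lebesgue measure. Algorithms. $\mathcal{A}_n$ is the set of all maps $A$ that assign to each $f\in\mathcal{F}_n$ and $(\mathbf{x},x_{n+1})\in[0,1)^{n+1}$ a finite or infinite string $A(f,\mathbf{x},x_{n+1})$ of cuts and satisfy: (1) (unrevealed bits have no influence) for all $f\in\mathcal{F}_n$, all integers $p_1,\ldots,p_{n+1}\ge 0$ and all points $(\mathbf{x},x_{n+1}),(\mathbf{x}',x'_{n+1})\in[0,1)^{n+1}$ with $x_j^{(i)}=x_j'^{(i)}$ for all $1\le i\le p_j$, $1\le j\le n+1$: if $s$ is a finite prefix of $A(f,\mathbf{x},x_{n+1})$ containing $\bar{x}_j$ at most $p_j$ times for each $j$, then for every $\ell\le|s|+1$ the length-$\ell$ prefixes of $A(f,\mathbf{x},x_{n+1})$ and $A(f,\mathbf{x}',x'_{n+1})$ are identical (the length-$\ell$ prefix of a string of length less than $\ell$ being the string itself); (2) (halting) if $A(f,\mathbf{x},x_{n+1})$ is a finite string $s$, then $f$ does not cross the feasible set after $s$ for the input $(\mathbf{x},x_{n+1})$. $|\cdot|$ denotes the length of a string (possibly $\infty$). The quantity $\mathcal{B}(n)$. With $X_1,\ldots,X_{n+1}$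 independent and uniform on $[0,1)$ and $A(f)=A(f,X_1,\ldots,X_{n+1})$, $$\mathcal{B}(n)=\inf_{A\in\mathcal{A}_n}\ \sup_{f\in\mathcal{F}_n}\ \mathbb{E}|A(f)|.$$ *)

theory Defs
  imports "HOL-Probability.Probability" "HOL-Library.Stream"
begin

section \<open>Unit cubes and increasing functions\<close>

text \<open>Points of \<open>[0,1)\<^sup>n\<close> are extensional functions on \<open>{1..n}\<close>; the pair
  \<open>(\<^bold>x, x\<^sub>n\<^sub>+\<^sub>1)\<close> is one point \<open>p\<close> of \<open>cube (n + 1)\<close>, with
  \<open>\<^bold>x = restrict p {1..n}\<close> and \<open>x\<^sub>n\<^sub>+\<^sub>1 = p (n + 1)\<close>.\<close>

definition cube :: "nat \<Rightarrow> (nat \<Rightarrow> real) set" where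
  "cube n = {1..n} \<rightarrow>\<^sub>E {0..<1}"

definition incr_funs :: "nat \<Rightarrow> ((nat \<Rightarrow> real) \<Rightarrow> real) set" where
  "incr_funs n = {f \<in> cube n \<rightarrow>\<^sub>E {0..<1}.
     \<forall>x'\<in>cube n. \<forall>x\<in>cube n. (\<forall>i\<in>{1..n}. x' i \<le> x i) \<longrightarrow> f x' \<le> f x}"


section \<open>Binary digits\<close>

text \<open>For \<open>i \<ge> 1\<close> and \<open>0 \<le> x < 1\<close> this is the \<open>i\<close>-th digit of the binary expansion of \<open>x\<close>
  that does not end in an infinite tail of ones; see the lemmas \<open>bin_digit_sums\<close> and
  \<open>bin_digit_no_tail_of_ones\<close> below.\<close>

definition bin_digit :: "real \<Rightarrow> nat \<Rightarrow> nat" where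
  "bin_digit x i = nat (\<lfloor>2 ^ i * x\<rfloor> mod 2)"

definition bin_trunc :: "real \<Rightarrow> nat \<Rightarrow> real" where
  "bin_trunc x k = (\<Sum>i=1..k. real (bin_digit x i) / 2 ^ i)"

lemma bin_digit_01: "bin_digit x i \<in> {0, 1}"
  unfolding bin_digit_def by auto

lemma bin_trunc_eq_floor:
  assumes "0 \<le> x" "x < 1"
  shows "bin_trunc x k = of_int \<lfloor>2 ^ k * x\<rfloor> / 2 ^ k"
proof (induction k)
  case 0
  have "\<lfloor>x\<rfloor> = 0" using assms by (simp add: floor_eq_iff)
  then show ?case by (simp add: bin_trunc_def)
next
  case (Suc k)
  define a where "a = \<lfloor>2 ^ Suc k * x\<rfloor>"
  have "a div 2 = \<lfloor>(2 ^ Suc k * x) / of_int 2\<rfloor>"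
    unfolding a_def by (subst floor_divide_real_eq_div) auto
  then have "a div 2 = \<lfloor>2 ^ k * x\<rfloor>" by simp
  then have "a = 2 * \<lfloor>2 ^ k * x\<rfloor> + int (bin_digit x (Suc k))"
    unfolding bin_digit_def a_def[symmetric] by (metis mult_div_mod_eq nat_0_le pos_mod_sign zero_less_numeral)
  then have "real_of_int a = 2 * real_of_int \<lfloor>2 ^ k * x\<rfloor> + real (bin_digit x (Suc k))"
    by (metis of_int_add of_int_mult of_int_numeral of_int_of_nat_eq)
  then show ?case
    using Suc unfolding a_def[symmetric] by (simp add: bin_trunc_def field_simps)
qed

lemma bin_trunc_bounds:
  assumes "0 \<le> x" "x < 1"
  shows "bin_trunc x k \<le> x" "x < bin_trunc x k + 1 / 2 ^ k"
proof -
  have "real_of_int \<lfloor>2 ^ k * x\<rfloor> \<le> 2 ^ k * x" "2 ^ k * x < real_of_int \<lfloor>2 ^ k * x\<rfloor> + 1"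
    by linarith+
  then show "bin_trunc x k \<le> x" "x < bin_trunc x k + 1 / 2 ^ k"
    by (simp_all add: bin_trunc_eq_floor[OF assms] field_simps)
qed

lemma bin_digit_sums:
  assumes "0 \<le> x" "x < 1"
  shows "(\<lambda>i. real (bin_digit x (Suc i)) / 2 ^ Suc i) sums x"
proof -
  have eq: "(\<Sum>i<k. real (bin_digit x (Suc i)) / 2 ^ Suc i) = bin_trunc x k" for k
    unfolding bin_trunc_def by (induction k) auto
  have lim: "(\<lambda>k. x - 1 / 2 ^ k) \<longlonglongrightarrow> x"
    using tendsto_diff[OF tendsto_const LIMSEQ_divide_realpow_zero[of 2 1]] by simp
  have "bin_trunc x \<longlonglongrightarrow> x"
    by (rule tendsto_sandwich[OF _ _ lim tendsto_const])
       (use bin_trunc_bounds[OF assms] in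
         \<open>auto intro!: always_eventually simp: algebra_simps less_imp_le\<close>)
  then show ?thesis unfolding sums_def eq .
qed

lemma bin_digit_no_tail_of_ones:
  assumes "0 \<le> x" "x < 1"
  shows "\<not> (\<exists>N. \<forall>i>N. bin_digit x i = 1)"
proof
  assume "\<exists>N. \<forall>i>N. bin_digit x i = 1"
  then obtain N where N: "\<And>i. i > N \<Longrightarrow> bin_digit x i = 1" by blast
  have eq: "bin_trunc x (N + m) = bin_trunc x N + 1 / 2 ^ N - 1 / 2 ^ (N + m)" for m
  proof (induction m)
    case (Suc m)
    have "bin_trunc x (N + Suc m) = bin_trunc x (N + m) + 1 / 2 ^ Suc (N + m)"
      using N[of "Suc (N + m)"] by (simp add: bin_trunc_def)
    then show ?case using Suc by (simp add: field_simps)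
  qed simp
  have lim: "(\<lambda>m. bin_trunc x N + 1 / 2 ^ N - 1 / 2 ^ (m + N)) \<longlonglongrightarrow> bin_trunc x N + 1 / 2 ^ N - 0"
    by (intro tendsto_diff tendsto_const LIMSEQ_ignore_initial_segment LIMSEQ_divide_realpow_zero) simp
  have "bin_trunc x N + 1 / 2 ^ N - 0 \<le> x"
    by (rule LIMSEQ_le_const2[OF lim])
       (use bin_trunc_bounds(1)[OF assms] in \<open>metis eq add.commute\<close>)
  then show False using bin_trunc_bounds(2)[OF assms, of N] by simp
qed


section \<open>Finite or infinite strings\<close>

datatype 'a fi_string = Fin "'a list" | Inf "'a stream"

fun str_length :: "'a fi_string \<Rightarrow> enat" where
  "str_length (Fin s) = enat (length s)"
| "str_length (Inf s) = \<infinity>"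

text \<open>The prefix of length \<open>l\<close>, or the whole string if that is shorter.\<close>

fun str_take :: "nat \<Rightarrow> 'a fi_string \<Rightarrow> 'a list" where
  "str_take l (Fin s) = take l s"
| "str_take l (Inf s) = stake l s"

definition is_prefix :: "'a list \<Rightarrow> 'a fi_string \<Rightarrow> bool" where
  "is_prefix s w \<longleftrightarrow> str_take (length s) w = s"


section \<open>Feasible sets, crossing and algorithms\<close>

text \<open>The cut revealing bits of coordinate \<open>j\<close> is represented by the index \<open>j \<in> {1..n + 1}\<close>.\<close>

definition feasible :: "nat \<Rightarrow> nat list \<Rightarrow> (nat \<Rightarrow> real) \<Rightarrow> (nat \<Rightarrow> real) set" where
  "feasible n s x = (\<Pi>\<^sub>E j\<in>{1..n + 1}.
     {bin_trunc (x j) (count_list s j) ..<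
      bin_trunc (x j) (count_list s j) + 1 / 2 ^ count_list s j})"

text \<open>Lebesgue measure on \<open>\<real>\<^sup>d\<close>. The completion matters: an increasing function of two or
  more variables need not be Borel measurable, but it is Lebesgue measurable.\<close>

definition lebesgue_dim :: "nat \<Rightarrow> (nat \<Rightarrow> real) measure" where
  "lebesgue_dim d = completion (\<Pi>\<^sub>M i\<in>{1..d}. lborel)"

definition crosses :: "nat \<Rightarrow> ((nat \<Rightarrow> real) \<Rightarrow> real) \<Rightarrow> (nat \<Rightarrow> real) set \<Rightarrow> bool" where
  "crosses n f S \<longleftrightarrow>
     emeasure (lebesgue_dim (n + 1)) (S \<inter> {y. f (restrict y {1..n}) < y (n + 1)}) > 0 \<and>
     emeasure (lebesgue_dim (n + 1)) (S \<inter> {y. f (restrict y {1..n}) > y (n + 1)}) > 0"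

type_synonym algorithm = "((nat \<Rightarrow> real) \<Rightarrow> real) \<Rightarrow> (nat \<Rightarrow> real) \<Rightarrow> nat fi_string"

definition unrevealed_bits_irrelevant :: "nat \<Rightarrow> algorithm \<Rightarrow> bool" where
  "unrevealed_bits_irrelevant n A \<longleftrightarrow>
     (\<forall>f\<in>incr_funs n. \<forall>p :: nat \<Rightarrow> nat. \<forall>x\<in>cube (n + 1). \<forall>x'\<in>cube (n + 1).
        (\<forall>j\<in>{1..n + 1}. \<forall>i\<in>{1..p j}. bin_digit (x j) i = bin_digit (x' j) i) \<longrightarrow>
        (\<forall>s. is_prefix s (A f x) \<and> (\<forall>j\<in>{1..n + 1}. count_list s j \<le> p j) \<longrightarrow>
             (\<forall>l \<le> length s + 1. str_take l (A f x) = str_take l (A f x'))))"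

definition halting_correct :: "nat \<Rightarrow> algorithm \<Rightarrow> bool" where
  "halting_correct n A \<longleftrightarrow>
     (\<forall>f\<in>incr_funs n. \<forall>x\<in>cube (n + 1). \<forall>s.
        A f x = Fin s \<longrightarrow> \<not> crosses n f (feasible n s x))"

definition algorithms :: "nat \<Rightarrow> algorithm set" where
  "algorithms n = {A.
     (\<forall>f\<in>incr_funs n. \<forall>x\<in>cube (n + 1). set_fi_string (A f x) \<subseteq> {1..n + 1}) \<and>
     unrevealed_bits_irrelevant n A \<and> halting_correct n A}"


section \<open>The optimal worst-case expected number of cuts\<close>

definition uniform_point :: "nat \<Rightarrow> (nat \<Rightarrow> real) measure" where
  "uniform_point d = (\<Pi>\<^sub>M i\<in>{1..d}. uniform_measure lborel {0..<1})"

definition expected_cuts ::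
    "nat \<Rightarrow> algorithm \<Rightarrow> ((nat \<Rightarrow> real) \<Rightarrow> real) \<Rightarrow> ennreal" where
  "expected_cuts n A f =
     (\<integral>\<^sup>+ x. ennreal_of_enat (str_length (A f x)) \<partial>uniform_point (n + 1))"

definition optimal_cuts :: "nat \<Rightarrow> ennreal" where
  "optimal_cuts n = (INF A\<in>algorithms n. SUP f\<in>incr_funs n. expected_cuts n A f)"

definition hfun :: "nat \<Rightarrow> (nat \<Rightarrow> real) \<Rightarrow> real" where
  "hfun n = (\<lambda>x\<in>cube n.
     min (1 - 1 / 2 ^ (n + 1)) ((2 ^ (n + 1) - 1) * (MIN i\<in>{1..n}. x i)))"

end

theory Submission imports Defs begin

text \<open>
  The function \<open>h\<^sub>n\<close> crosses every feasible box cut at most \<open>n\<close> times, whatever the input,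
  so halting after at most \<open>n\<close> cuts is never correct. The corner of the box where \<open>\<^bold>x\<close> is large and
  \<open>x\<^sub>n\<^sub>+\<^sub>1\<close> is small always lies below the graph of \<open>h\<^sub>n\<close>. Moreover, one of the \<open>n + 1\<close> coordinates is
  uncut: if it is \<open>x\<^sub>n\<^sub>+\<^sub>1\<close>, then \<open>x\<^sub>n\<^sub>+\<^sub>1\<close> can exceed the maximum \<open>1 - 2\<^sup>-\<^sup>(\<^sup>n\<^sup>+\<^sup>1\<^sup>)\<close> of \<open>h\<^sub>n\<close>; otherwise
  some \<open>x\<^sub>i\<close> with \<open>i \<le> n\<close> can be so close to \<open>0\<close> that \<open>h\<^sub>n\<close> is below \<open>x\<^sub>n\<^sub>+\<^sub>1\<close>.
\<close>

lemma restrict_in_cube: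
  assumes "y \<in> cube (n + 1)"
  shows "restrict y {1..n} \<in> cube n"
  using assms by (auto simp: cube_def PiE_iff)

lemma hfun_restrict:
  assumes "y \<in> cube (n + 1)"
  shows "hfun n (restrict y {1..n}) =
    min (1 - 1 / 2 ^ (n + 1)) ((2 ^ (n + 1) - 1) * (MIN i\<in>{1..n}. y i))"
proof -
  have "restrict y {1..n} ` {1..n} = y ` {1..n}" by auto
  then show ?thesis
    using restrict_in_cube[OF assms] by (simp add: hfun_def)
qed

text \<open>The cap \<open>1 - 1 / 2 ^ (n + 1)\<close> keeps the values below 1. Monotonicity passes
  from the coordinates to their minimum, through the nonnegative factor, and through the
  cap.\<close>

lemma hfun_in_incr_funs:
  assumes "n \<ge> 1"
  shows "hfun n \<in> incr_funs n"
proof -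
  have ne: "{1..n} \<noteq> {}" using assms by auto
  have one: "(1::real) \<le> 2 ^ (n + 1)" by (rule one_le_power) simp
  have range: "hfun n x \<in> {0..<1}" if x: "x \<in> cube n" for x
  proof -
    have "0 \<le> (MIN i\<in>{1..n}. x i)"
      using x ne by (subst Min_ge_iff) (auto simp: cube_def PiE_iff)
    then have "0 \<le> (2 ^ (n + 1) - 1) * (MIN i\<in>{1..n}. x i)"
      using one by (intro mult_nonneg_nonneg) auto
    then have "0 \<le> hfun n x"
      using x one by (simp add: hfun_def)
    moreover have "hfun n x \<le> 1 - 1 / 2 ^ (n + 1)"
      using x by (simp add: hfun_def)
    moreover have "(1::real) - 1 / 2 ^ (n + 1) < 1"
      by simp
    ultimately show ?thesis by (meson atLeastLessThan_iff le_less_trans)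
  qed
  have mono: "hfun n x' \<le> hfun n x"
    if x: "x \<in> cube n" and x': "x' \<in> cube n" and le: "\<forall>i\<in>{1..n}. x' i \<le> x i" for x x'
  proof -
    have "(MIN i\<in>{1..n}. x' i) \<le> (MIN i\<in>{1..n}. x i)"
    proof (subst Min_ge_iff)
      show "\<forall>a\<in>x ` {1..n}. (MIN i\<in>{1..n}. x' i) \<le> a"
        using le by (auto intro: order_trans[OF Min_le])
    qed (use ne in auto)
    then have "(2 ^ (n + 1) - 1) * (MIN i\<in>{1..n}. x' i) \<le> (2 ^ (n + 1) - 1) * (MIN i\<in>{1..n}. x i)"
      using one by (intro mult_left_mono) auto
    then show ?thesis using x x' by (simp add: hfun_def min_def)
  qed
  show ?thesis
    unfolding incr_funs_def using range mono by (auto simp: hfun_def)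
qed

text \<open>Reduces each half of \<open>crosses\<close> to exhibiting a nondegenerate open box: its
  volume is the product of its side lengths, and on product-measurable sets the completion agrees
  with the product measure.\<close>

lemma emeasure_lebesgue_dim_pos:
  assumes "M \<in> sets (\<Pi>\<^sub>M i\<in>{1..d}. lborel)"
    and "(\<Pi>\<^sub>E i\<in>{1..d}. {a i<..<b i}) \<subseteq> M"
    and "\<And>i. i \<in> {1..d} \<Longrightarrow> a i < b i"
  shows "emeasure (lebesgue_dim d) M > 0"
proof -
  interpret product_sigma_finite "\<lambda>_::nat. lborel :: real measure" ..
  have "emeasure (\<Pi>\<^sub>M i\<in>{1..d}. lborel) (\<Pi>\<^sub>E i\<in>{1..d}. {a i<..<b i}) =
      (\<Prod>i=1..d. emeasure lborel {a i<..<b i})"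
    by (rule emeasure_PiM) auto
  also have "\<dots> = (\<Prod>i=1..d. ennreal (b i - a i))"
    using assms(3) by (intro prod.cong refl) (auto simp: less_imp_le)
  also have "\<dots> = ennreal (\<Prod>i=1..d. b i - a i)"
    using assms(3) by (intro prod_ennreal) (auto simp: less_imp_le)
  also have "\<dots> > 0"
    using assms(3) by (auto intro!: prod_pos)
  finally have "emeasure (\<Pi>\<^sub>M i\<in>{1..d}. lborel) M > 0"
    using emeasure_mono[OF assms(2,1)] by (rule less_le_trans)
  then show ?thesis
    using assms(1) by (simp add: lebesgue_dim_def)
qed

text \<open>For the upper end: the integer \<open>\<lfloor>2 ^ k * x\<rfloor>\<close> is less than
  \<open>2 ^ k\<close>, so its successor is at most \<open>2 ^ k\<close>.\<close>

lemma bin_trunc_cell_in_unit_interval: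
  assumes "0 \<le> x" "x < 1"
  shows "0 \<le> bin_trunc x k" "bin_trunc x k + 1 / 2 ^ k \<le> 1"
proof -
  have "2 ^ k * x < 2 ^ k" using assms by simp
  then have "\<lfloor>2 ^ k * x\<rfloor> < 2 ^ k" by (simp add: floor_less_iff)
  then have "\<lfloor>2 ^ k * x\<rfloor> + 1 \<le> 2 ^ k" by linarith
  then have "real_of_int (\<lfloor>2 ^ k * x\<rfloor> + 1) \<le> real_of_int (2 ^ k)"
    by (simp only: of_int_le_iff)
  then show "bin_trunc x k + 1 / 2 ^ k \<le> 1"
    by (simp add: bin_trunc_eq_floor[OF assms] field_simps)
  show "0 \<le> bin_trunc x k"
    using assms by (simp add: bin_trunc_def sum_nonneg)
qed

text \<open>Abstracts \<open>feasible\<close> to left endpoints \<open>l\<close> and cut counts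
  \<open>k\<close>. Each of the two sets in \<open>crosses\<close> contains an open box placed at
  suitable ends of the cells.\<close>

lemma hfun_crosses_box:
  fixes l :: "nat \<Rightarrow> real" and k :: "nat \<Rightarrow> nat"
  assumes n: "n \<ge> 1"
    and l0: "\<And>j. j \<in> {1..n + 1} \<Longrightarrow> 0 \<le> l j"
    and l1: "\<And>j. j \<in> {1..n + 1} \<Longrightarrow> l j + 1 / 2 ^ k j \<le> 1"
    and sum: "(\<Sum>j=1..n + 1. k j) \<le> n"
  shows "crosses n (hfun n) (\<Pi>\<^sub>E j\<in>{1..n + 1}. {l j..<l j + 1 / 2 ^ k j})"
    (is "crosses n _ ?S")
proof -
  let ?M = "\<Pi>\<^sub>M i\<in>{1..n + 1}. (lborel :: real measure)"
  define e :: real where "e = 1 / 2 ^ (n + 1)"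
  \<comment> \<open>\<open>hfun n\<close> is \<open>undefined\<close> off the cube. The total
    formula \<open>g\<close> agrees with it on the box and is measurable everywhere; its slope
    \<open>1 / e - 1\<close> is \<open>2 ^ (n + 1) - 1\<close>.\<close>
  define g where "g y = min (1 - e) ((1 / e - 1) * (MIN i\<in>{1..n}. y i))" for y :: "nat \<Rightarrow> real"
  have e0: "e > 0" by (simp add: e_def)
  have e1: "1 / e > 1" unfolding e_def by (simp add: one_less_power del: power_Suc)
  have ne: "{1..n} \<noteq> {}" using n by auto
  have S_cube: "?S \<subseteq> cube (n + 1)"
    unfolding cube_def using l0 l1 by (intro PiE_mono) fastforce
  have h: "hfun n (restrict y {1..n}) = g y" if "y \<in> ?S" for y
    using hfun_restrict[of y n] S_cube that by (auto simp: g_def e_def)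
  have [measurable]: "g \<in> borel_measurable ?M"
    unfolding g_def by measurable
  have [measurable]: "(\<lambda>y. y (n + 1)) \<in> borel_measurable ?M"
    by measurable
  have S_meas: "?S \<in> sets ?M" by (intro sets_PiM_I_finite) auto
  have S_space: "?S \<subseteq> space ?M" using sets.sets_into_space[OF S_meas] .
  have lower: "?S \<inter> {y. hfun n (restrict y {1..n}) < y (n + 1)} =
      ?S \<inter> {y \<in> space ?M. g y < y (n + 1)}"
    using h S_space by auto
  have upper: "?S \<inter> {y. hfun n (restrict y {1..n}) > y (n + 1)} =
      ?S \<inter> {y \<in> space ?M. g y > y (n + 1)}"
    using h S_space by auto
  have lower_meas: "?S \<inter> {y \<in> space ?M. g y < y (n + 1)} \<in> sets ?M"
    using S_meas by (intro sets.Int) measurable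
  have upper_meas: "?S \<inter> {y \<in> space ?M. g y > y (n + 1)} \<in> sets ?M"
    using S_meas by (intro sets.Int) measurable

  have k_le: "k j \<le> n" if "j \<in> {1..n + 1}" for j
    using member_le_sum[of j "{1..n + 1}" k] that sum by auto
  \<comment> \<open>Every cell has length at least \<open>1 / 2 ^ n\<close>, so a piece of length
    \<open>e\<close> at one end still leaves a distance of at least \<open>e\<close> to the other
    end.\<close>
  have width: "2 * e \<le> 1 / 2 ^ k j" if "j \<in> {1..n + 1}" for j
    using power_increasing[OF k_le[OF that], of "2::real"] by (simp add: e_def field_simps)

  have "emeasure (lebesgue_dim (n + 1)) (?S \<inter> {y \<in> space ?M. g y > y (n + 1)}) > 0"
  proof (rule emeasure_lebesgue_dim_pos[OF upper_meas])
    \<comment> \<open>Top pieces of length \<open>e\<close> for the arguments, a bottom piece for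
      the last coordinate. All arguments then exceed \<open>e\<close>, which is where
      \<open>g\<close> reaches its cap \<open>1 - e\<close>, while the last coordinate stays below
      \<open>1 - e\<close>.\<close>
    define a where "a j = (if j = n + 1 then l j else l j + 1 / 2 ^ k j - e)" for j
    define b where "b j = (if j = n + 1 then l j + e else l j + 1 / 2 ^ k j)" for j
    show "a j < b j" for j using e0 by (simp add: a_def b_def)
    show "(\<Pi>\<^sub>E j\<in>{1..n + 1}. {a j<..<b j}) \<subseteq> ?S \<inter> {y \<in> space ?M. g y > y (n + 1)}"
    proof
      fix y assume y: "y \<in> (\<Pi>\<^sub>E j\<in>{1..n + 1}. {a j<..<b j})"
      have yj: "a j < y j" "y j < b j" if "j \<in> {1..n + 1}" for j
        using y that by (auto simp: PiE_iff)
      have yS: "y \<in> ?S"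
      proof (rule PiE_I)
        show "y j \<in> {l j..<l j + 1 / 2 ^ k j}" if "j \<in> {1..n + 1}" for j
          using yj[OF that] width[OF that] e0 by (auto simp: a_def b_def split: if_splits)
        show "y j = undefined" if "j \<notin> {1..n + 1}" for j
          using y that by (auto simp: PiE_iff extensional_def)
      qed
      have "y j \<ge> e" if "j \<in> {1..n}" for j
        using yj(1)[of j] width[of j] l0[of j] that by (auto simp: a_def split: if_splits)
      then have "(MIN i\<in>{1..n}. y i) \<ge> e"
        using ne by (subst Min_ge_iff) auto
      then have "(1 / e - 1) * (MIN i\<in>{1..n}. y i) \<ge> (1 / e - 1) * e"
        using e1 by (intro mult_left_mono) auto
      also have "(1 / e - 1) * e = 1 - e"
        using e0 by (simp add: field_simps)
      finally have "g y = 1 - e"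
        unfolding g_def by (rule min_absorb1)
      moreover have "y (n + 1) < 1 - e"
        using yj(2)[of "n + 1"] width[of "n + 1"] l1[of "n + 1"] by (auto simp: b_def)
      ultimately show "y \<in> ?S \<inter> {y \<in> space ?M. g y > y (n + 1)}"
        using yS S_space by auto
    qed
  qed
  moreover
  obtain m where m: "m \<in> {1..n + 1}" "k m = 0"
  proof (rule ccontr)
    assume "\<not> thesis"
    with that have "1 \<le> k j" if "j \<in> {1..n + 1}" for j
      using that by (metis less_one not_le)
    then have "(\<Sum>j=1..n + 1. 1) \<le> (\<Sum>j=1..n + 1. k j)"
      by (intro sum_mono) auto
    with sum show False by simp
  qed
  \<comment> \<open>The cell of the uncut coordinate is all of \<open>[0, 1)\<close>.\<close>
  have lm: "l m = 0" using l0[OF m(1)] l1[OF m(1)] m(2) by simp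
  have "emeasure (lebesgue_dim (n + 1)) (?S \<inter> {y \<in> space ?M. g y < y (n + 1)}) > 0"
  proof (rule emeasure_lebesgue_dim_pos[OF lower_meas])
    \<comment> \<open>The last coordinate gets the top piece, so it exceeds \<open>e\<close>, and
      even \<open>1 - e\<close> if it is the uncut one. Otherwise argument \<open>m\<close> is
      confined to \<open>(0, e\<^sup>2)\<close>, where the linear branch is below
      \<open>(1 / e - 1) * e\<^sup>2 = e - e\<^sup>2 < e\<close>.\<close>
    define a where "a j = (if j = n + 1 then l j + 1 / 2 ^ k j - e else l j)" for j
    define b where "b j = (if j = m \<and> m \<noteq> n + 1 then e\<^sup>2 else l j + 1 / 2 ^ k j)" for j
    have e2: "0 < e\<^sup>2" "e\<^sup>2 \<le> 1"
      using e0 e1 by (auto simp: field_simps intro!: power_le_one)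
    show "a j < b j" for j using e0 e2 lm by (auto simp: a_def b_def)
    show "(\<Pi>\<^sub>E j\<in>{1..n + 1}. {a j<..<b j}) \<subseteq> ?S \<inter> {y \<in> space ?M. g y < y (n + 1)}"
    proof
      fix y assume y: "y \<in> (\<Pi>\<^sub>E j\<in>{1..n + 1}. {a j<..<b j})"
      have yj: "a j < y j" "y j < b j" if "j \<in> {1..n + 1}" for j
        using y that by (auto simp: PiE_iff)
      have yS: "y \<in> ?S"
      proof (rule PiE_I)
        show "y j \<in> {l j..<l j + 1 / 2 ^ k j}" if "j \<in> {1..n + 1}" for j
          using yj[OF that] width[OF that] e0 e2 lm m(2)
          by (auto simp: a_def b_def split: if_splits)
        show "y j = undefined" if "j \<notin> {1..n + 1}" for j
          using y that by (auto simp: PiE_iff extensional_def)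
      qed
      have "g y < y (n + 1)"
      proof (cases "m = n + 1")
        case True
        have "g y \<le> 1 - e" by (simp add: g_def)
        also have "\<dots> < y (n + 1)"
          using yj(1)[of "n + 1"] True lm m(2) by (simp add: a_def)
        finally show ?thesis .
      next
        case False
        then have m': "m \<in> {1..n}" using m(1) by auto
        have "(MIN i\<in>{1..n}. y i) \<le> y m" using m' by (intro Min_le) auto
        also have "\<dots> < e\<^sup>2" using yj(2)[OF m(1)] False by (simp add: b_def)
        finally have "(1 / e - 1) * (MIN i\<in>{1..n}. y i) < (1 / e - 1) * e\<^sup>2"
          using e1 by (intro mult_strict_left_mono) auto
        also have "\<dots> = e - e\<^sup>2"
          using e0 by (simp add: field_simps power2_eq_square)
        also have "\<dots> < e" using e0 by simp
        finally have "g y < e" unfolding g_def by (rule min.strict_coboundedI2)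
        also have "e < y (n + 1)"
          using yj(1)[of "n + 1"] width[of "n + 1"] l0[of "n + 1"] by (simp add: a_def)
        finally show ?thesis .
      qed
      then show "y \<in> ?S \<inter> {y \<in> space ?M. g y < y (n + 1)}"
        using yS S_space by auto
    qed
  qed
  ultimately show ?thesis
    unfolding crosses_def lower upper by blast
qed

text \<open>A halt after at most \<open>n\<close> cuts would leave a box that \<open>hfun n\<close>
  crosses, against \<open>halting_correct\<close>; an infinite string has length
  \<open>\<infinity>\<close>.\<close>

lemma str_length_hfun_ge:
  assumes n: "n \<ge> 1" and A: "A \<in> algorithms n" and x: "x \<in> cube (n + 1)"
  shows "str_length (A (hfun n) x) \<ge> enat (n + 1)"
proof (cases "A (hfun n) x")
  case (Fin s)
  have h: "hfun n \<in> incr_funs n" using hfun_in_incr_funs[OF n] .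
  have "\<not> crosses n (hfun n) (feasible n s x)"
    using A h x Fin unfolding algorithms_def halting_correct_def by blast
  moreover have "crosses n (hfun n) (feasible n s x)" if "length s \<le> n"
    unfolding feasible_def
  proof (rule hfun_crosses_box[OF n])
    fix j assume "j \<in> {1..n + 1}"
    then have "0 \<le> x j" "x j < 1" using x by (auto simp: cube_def PiE_iff)
    then show "0 \<le> bin_trunc (x j) (count_list s j)"
      "bin_trunc (x j) (count_list s j) + 1 / 2 ^ count_list s j \<le> 1"
      by (rule bin_trunc_cell_in_unit_interval)+
  next
    have "set_fi_string (A (hfun n) x) \<subseteq> {1..n + 1}"
      using A h x unfolding algorithms_def by blast
    then have "set s \<subseteq> {1..n + 1}" using Fin by simp
    \<comment> \<open>All symbols of \<open>s\<close> lie in \<open>{1..n + 1}\<close>, so the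
      counts add up to \<open>length s\<close>.\<close>
    then show "(\<Sum>j=1..n + 1. count_list s j) \<le> n"
      using that by (subst sum_count_set) auto
  qed
  ultimately have "n < length s" by (meson not_le)
  then show ?thesis using Fin by simp
qed simp

text \<open>\<open>uniform_point d\<close> lives on all extensional real vectors, whereas bounds on
  algorithms hold only on the cube; this shows that the cube carries the full mass.\<close>

lemma emeasure_uniform_point_cube:
  "cube d \<in> sets (uniform_point d)" "emeasure (uniform_point d) (cube d) = 1"
proof -
  let ?U = "uniform_measure lborel {0..<1::real}"
  interpret prob_space ?U by (rule prob_space_uniform_measure) auto
  interpret product_sigma_finite "\<lambda>_::nat. ?U" ..
  show "cube d \<in> sets (uniform_point d)"
    unfolding cube_def uniform_point_def by (intro sets_PiM_I_finite) auto
  have "emeasure (uniform_point d) (cube d) = (\<Prod>i=1..d. emeasure ?U {0..<1})"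
    unfolding cube_def uniform_point_def by (rule emeasure_PiM) auto
  also have "\<dots> = 1" by (intro prod.neutral) simp
  finally show "emeasure (uniform_point d) (cube d) = 1" .
qed

text \<open>Compares the length with \<open>m\<close> times the indicator of the cube. The
  nonnegative integral is monotone for arbitrary integrands, so the length may be nonmeasurable in
  \<open>x\<close>.\<close>

lemma expected_cuts_ge:
  assumes "\<And>x. x \<in> cube (n + 1) \<Longrightarrow> str_length (A f x) \<ge> enat m"
  shows "expected_cuts n A f \<ge> of_nat m"
proof -
  have "of_nat m = (\<integral>\<^sup>+ x. of_nat m * indicator (cube (n + 1)) x \<partial>uniform_point (n + 1))"
    using emeasure_uniform_point_cube[of "n + 1"] by (simp add: nn_integral_cmult_indicator)
  also have "\<dots> \<le> expected_cuts n A f"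
    unfolding expected_cuts_def
  proof (rule nn_integral_mono)
    fix x
    show "of_nat m * indicator (cube (n + 1)) x \<le> ennreal_of_enat (str_length (A f x))"
      using assms[of x] ennreal_of_enat_le_iff[of "enat m"]
      by (auto simp: indicator_def)
  qed
  finally show ?thesis .
qed

theorem theorem2:
  fixes n :: nat
  assumes "n \<ge> 1"
  shows "hfun n \<in> incr_funs n \<and>
         (\<forall>A\<in>algorithms n. \<forall>x\<in>cube (n + 1). str_length (A (hfun n) x) \<ge> enat (n + 1)) \<and>
         optimal_cuts n \<ge> of_nat (n + 1)"
proof (intro conjI ballI)
  show h: "hfun n \<in> incr_funs n" using hfun_in_incr_funs[OF assms] .
  show "str_length (A (hfun n) x) \<ge> enat (n + 1)"
    if "A \<in> algorithms n" "x \<in> cube (n + 1)" for A x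
    using str_length_hfun_ge[OF assms that] .
  show "optimal_cuts n \<ge> of_nat (n + 1)"
    unfolding optimal_cuts_def
  proof (rule INF_greatest)
    fix A assume "A \<in> algorithms n"
    then have "of_nat (n + 1) \<le> expected_cuts n A (hfun n)"
      by (intro expected_cuts_ge str_length_hfun_ge[OF assms])
    also have "\<dots> \<le> (SUP f\<in>incr_funs n. expected_cuts n A f)"
      by (rule SUP_upper[OF h])
    finally show "of_nat (n + 1) \<le> (SUP f\<in>incr_funs n. expected_cuts n A f)" .
  qed
qed

end
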